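(* Let $G$ be a graph with a length-function $\ell$ and let $C\subseteq G$ be a cycle. If $C$ is $6$-geodesic in $G$, then $C$ is fully geodesic in $G$.
   Context: All graphs are finite; parallel edges are allowed, loops are not; a cycle may consist of two vertices joined by two parallel edges. A length-function on a graph $G$ is a map $\ell:E(G)\to\mathbb{R}^+$ (strictly positive reals); for a subgraph $H$ put $\ell(H)=\sum_{e\in E(H)}\ell(e)$, and subgraphs carry the restricted length-function. For $A\subseteq V(G)$, the Steiner distance $\mathrm{sd}_G(A)$ is the minimum of $\ell(S)$ over all connected subgraphs $S\subseteq G$ with $A\subseteq V(S)$ ($\infty$ if none exists). A subgraph $H\subseteq G$ is $k$-geodesic in $G$ if $\mathrm{sd}_H(A)=\mathrm{sd}_G(A)$ for every $A\subseteq V(H)$ with $|A|\le k$; it is fully geodesic in $G$ if it is $k$-geodesic for every $k\in\mathbb{N}$. *)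

theory Defs
  imports Complex_Main "HOL-Library.Extended_Real"
begin

text \<open>Multigraphs: a vertex set V, an edge set E, and an incidence map ends assigning
  to each edge its set of two (distinct) endpoints. Parallel edges allowed, loops not.\<close>

definition graph :: "'v set \<Rightarrow> 'e set \<Rightarrow> ('e \<Rightarrow> 'v set) \<Rightarrow> bool" where
  "graph V E ends \<longleftrightarrow> finite V \<and> finite E \<and> (\<forall>e\<in>E. card (ends e) = 2 \<and> ends e \<subseteq> V)"

definition subgraph :: "'v set \<Rightarrow> 'e set \<Rightarrow> 'v set \<Rightarrow> 'e set \<Rightarrow> ('e \<Rightarrow> 'v set) \<Rightarrow> bool" where
  "subgraph V' E' V E ends \<longleftrightarrow> V' \<subseteq> V \<and> E' \<subseteq> E \<and> (\<forall>e\<in>E'. ends e \<subseteq> V')"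

definition adj :: "'e set \<Rightarrow> ('e \<Rightarrow> 'v set) \<Rightarrow> ('v \<times> 'v) set" where
  "adj E ends = {(x, y). \<exists>e\<in>E. ends e = {x, y}}"

definition connected_graph :: "'v set \<Rightarrow> 'e set \<Rightarrow> ('e \<Rightarrow> 'v set) \<Rightarrow> bool" where
  "connected_graph V E ends \<longleftrightarrow> V \<noteq> {} \<and> (\<forall>u\<in>V. \<forall>v\<in>V. (u, v) \<in> (adj E ends)\<^sup>*)"

text \<open>Length of a subgraph: sum of the lengths of its edges.\<close>
definition glen :: "('e \<Rightarrow> real) \<Rightarrow> 'e set \<Rightarrow> real" where
  "glen len E = (\<Sum>e\<in>E. len e)"

text \<open>Steiner distance of A in the graph (V,E): minimum length of a connected subgraph
  containing A (infinity if none). Graphs are finite, so the infimum is a minimum.\<close>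
definition steiner_dist :: "('e \<Rightarrow> 'v set) \<Rightarrow> ('e \<Rightarrow> real) \<Rightarrow> 'v set \<Rightarrow> 'e set \<Rightarrow> 'v set \<Rightarrow> ereal" where
  "steiner_dist ends len V E A =
     Inf {ereal (glen len E') | V' E'. subgraph V' E' V E ends \<and> connected_graph V' E' ends \<and> A \<subseteq> V'}"

definition k_geodesic :: "nat \<Rightarrow> ('e \<Rightarrow> 'v set) \<Rightarrow> ('e \<Rightarrow> real) \<Rightarrow> 'v set \<Rightarrow> 'e set \<Rightarrow> 'v set \<Rightarrow> 'e set \<Rightarrow> bool" where
  "k_geodesic k ends len VH EH V E \<longleftrightarrow>
     (\<forall>A. A \<subseteq> VH \<and> card A \<le> k \<longrightarrow> steiner_dist ends len VH EH A = steiner_dist ends len V E A)"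

definition fully_geodesic :: "('e \<Rightarrow> 'v set) \<Rightarrow> ('e \<Rightarrow> real) \<Rightarrow> 'v set \<Rightarrow> 'e set \<Rightarrow> 'v set \<Rightarrow> 'e set \<Rightarrow> bool" where
  "fully_geodesic ends len VH EH V E \<longleftrightarrow> (\<forall>k. k_geodesic k ends len VH EH V E)"

text \<open>A cycle: distinct vertices v_0..v_(n-1) (n >= 2) and distinct edges e_0..e_(n-1)
  with e_i joining v_i and v_(i+1 mod n); the graph consists exactly of these.\<close>
definition is_cycle :: "('e \<Rightarrow> 'v set) \<Rightarrow> 'v set \<Rightarrow> 'e set \<Rightarrow> bool" where
  "is_cycle ends VC EC \<longleftrightarrow>
     (\<exists>vs es. length vs \<ge> 2 \<and> length es = length vs \<and> distinct vs \<and> distinct es \<and>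
        (\<forall>i<length vs. ends (es ! i) = {vs ! i, vs ! ((i + 1) mod length vs)}) \<and>
        VC = set vs \<and> EC = set es)"

end

theory Submission
  imports Defs
begin

text \<open>
  Let \<open>A\<close> be a smallest set of vertices of the cycle \<open>C\<close> that is connected in the graph by an edge
  set \<open>T\<close> shorter than \<open>sd\<^sub>C A\<close>; then \<open>A\<close> has at least seven elements. Start anywhere and walk along
  \<open>T\<close> as long as a single edge leads to at least three elements of \<open>A\<close>. At the vertex \<open>w\<close> where this
  ends, two edge-disjoint pieces of \<open>T\<close> with at most two elements of \<open>A\<close> each have at least three
  together, which leaves at least three elements elsewhere. Walk on from \<open>w\<close> to the vertex \<open>z\<close> where
  the latter branch. So \<open>T\<close> contains an H-shape: a path \<open>P\<close> from \<open>w\<close> to \<open>z\<close> with two pieces attached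
  at either end, which partition \<open>A\<close> into \<open>X1, X2\<close> and \<open>Y1, Y2\<close> with \<open>X1 \<union> X2\<close> and \<open>Y1 \<union> Y2\<close> of size
  at least three.

  By minimality every proper subset \<open>B\<close> of \<open>A\<close> lies on an arc of \<open>C\<close> of length at most \<open>sd\<^sub>G B\<close>. If
  \<open>T\<close> contains edge-disjoint connections of \<open>Z\<close> and of \<open>A - Z\<close>, then the arcs for \<open>Z\<close> and \<open>A - Z\<close>
  cannot meet, since their union would connect \<open>A\<close> too cheaply. So each of the four parts is an
  interval of the cyclic order, which up to names is \<open>X1, X2, Y1, Y2\<close>. The lengths of the arcs for
  \<open>X1 \<union> X2\<close>, \<open>Y1 \<union> Y2\<close>, \<open>X1 \<union> Y1\<close> and \<open>X2 \<union> Y2\<close> add up to at most twice that of \<open>T\<close>, because \<open>P\<close> is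
  unused by the first two and used by both of the last two; whichever way round \<open>C\<close> the last two
  arcs go, this sum exceeds twice the length of \<open>T\<close>.
\<close>

section \<open>Splits of a set by an H-shape\<close>

text \<open>The conditions on \<open>f\<close> hold if \<open>f\<close> measures the shortest connections of \<open>A\<close> and a shortest
  connection of all of \<open>A\<close> is a path with \<open>X1, X2\<close> attached at one end and \<open>Y1, Y2\<close> at the other:
  the path is unused in \<open>f (X1 \<union> X2) + f (Y1 \<union> Y2)\<close> and used twice in
  \<open>f (X1 \<union> Y1) + f (X2 \<union> Y2)\<close>.\<close>

definition H_split ::
    "('a set \<Rightarrow> real) \<Rightarrow> 'a set \<Rightarrow> 'a set \<Rightarrow> 'a set \<Rightarrow> 'a set \<Rightarrow> 'a set \<Rightarrow> bool" where
  "H_split f A X1 X2 Y1 Y2 \<longleftrightarrow>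
     (X1 \<union> X2) \<union> (Y1 \<union> Y2) = A \<and>
     X1 \<inter> X2 = {} \<and> Y1 \<inter> Y2 = {} \<and> (X1 \<union> X2) \<inter> (Y1 \<union> Y2) = {} \<and>
     {} \<notin> {X1, X2, Y1, Y2} \<and> 3 \<le> card (X1 \<union> X2) \<and> 3 \<le> card (Y1 \<union> Y2) \<and>
     (\<forall>Z\<in>{X1, X2, Y1, Y2, X1 \<union> X2}. f Z + f (A - Z) \<le> f A) \<and>
     f (X1 \<union> X2) + f (Y1 \<union> Y2) + f (X1 \<union> Y1) + f (X2 \<union> Y2) \<le> 2 * f A \<and>
     f (X1 \<union> X2) + f (Y1 \<union> Y2) + f (X1 \<union> Y2) + f (X2 \<union> Y1) \<le> 2 * f A"

lemma H_split_swap_X: "H_split f A X1 X2 Y1 Y2 \<Longrightarrow> H_split f A X2 X1 Y1 Y2"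
  unfolding H_split_def by (simp add: Un_commute[of X2 X1] Int_commute[of X2 X1])

lemma H_split_swap_Y: "H_split f A X1 X2 Y1 Y2 \<Longrightarrow> H_split f A X1 X2 Y2 Y1"
  unfolding H_split_def by (simp add: Un_commute[of Y2 Y1] Int_commute[of Y2 Y1])

section \<open>Steiner distance and connecting edge sets\<close>

locale weighted_graph =
  fixes V :: "'v set" and E :: "'e set" and ends :: "'e \<Rightarrow> 'v set" and len :: "'e \<Rightarrow> real"
  assumes graph: "graph V E ends" and len_nonneg: "e \<in> E \<Longrightarrow> 0 \<le> len e"
begin

abbreviation sd :: "'v set \<Rightarrow> ereal" where
  "sd \<equiv> steiner_dist ends len V E"

definition connects :: "'e set \<Rightarrow> 'v set \<Rightarrow> bool" where
  "connects F U \<longleftrightarrow> (\<exists>W. subgraph W F V E ends \<and> connected_graph W F ends \<and> U \<subseteq> W)"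

lemma finite_E: "finite E"
  using graph unfolding graph_def by blast

lemma ends_subset: "e \<in> E \<Longrightarrow> ends e \<subseteq> V"
  using graph unfolding graph_def by blast

lemma ends_nonempty: "e \<in> E \<Longrightarrow> ends e \<noteq> {}"
  using graph unfolding graph_def by fastforce

lemma connects_subset: "connects F U \<Longrightarrow> F \<subseteq> E"
  unfolding connects_def subgraph_def by blast

lemma connects_vertices: "connects F U \<Longrightarrow> U \<subseteq> V"
  unfolding connects_def subgraph_def by blast

lemma connects_finite: "connects F U \<Longrightarrow> finite F"
  using connects_subset finite_E finite_subset by blast

lemma connects_singleton: "v \<in> V \<Longrightarrow> connects {} {v}"
  unfolding connects_def subgraph_def connected_graph_def by (intro exI[of _ "{v}"]) auto

lemma connects_edge:
  assumes "e \<in> E" "ends e = {u, v}"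
  shows "connects {e} {u, v}"
proof -
  have "(u, v) \<in> adj {e} ends" "(v, u) \<in> adj {e} ends"
    using assms(2) by (auto simp: adj_def)
  then have "connected_graph {u, v} {e} ends"
    unfolding connected_graph_def by auto
  moreover have "subgraph {u, v} {e} V E ends"
    using assms ends_subset[OF assms(1)] unfolding subgraph_def by auto
  ultimately show ?thesis unfolding connects_def by blast
qed

lemma adj_mono: "F \<subseteq> F' \<Longrightarrow> adj F ends \<subseteq> adj F' ends"
  unfolding adj_def by blast

lemma connects_union:
  assumes "connects F U" "connects F' U'" "x \<in> U" "x \<in> U'"
  shows "connects (F \<union> F') (U \<union> U')"
proof -
  obtain W where W: "subgraph W F V E ends" "connected_graph W F ends" "U \<subseteq> W"
    using assms(1) unfolding connects_def by blast
  obtain W' where W': "subgraph W' F' V E ends" "connected_graph W' F' ends" "U' \<subseteq> W'"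
    using assms(2) unfolding connects_def by blast
  have x: "x \<in> W" "x \<in> W'" using assms W W' by auto
  let ?R = "(adj (F \<union> F') ends)\<^sup>*"
  have "(adj F ends)\<^sup>* \<subseteq> ?R" "(adj F' ends)\<^sup>* \<subseteq> ?R"
    by (simp_all add: rtrancl_mono adj_mono)
  then have "(y, x) \<in> ?R \<and> (x, y) \<in> ?R" if "y \<in> W \<union> W'" for y
    using that W(2) W'(2) x unfolding connected_graph_def by blast
  then have "connected_graph (W \<union> W') (F \<union> F') ends"
    unfolding connected_graph_def using x by (blast intro: rtrancl_trans)
  moreover have "subgraph (W \<union> W') (F \<union> F') V E ends"
    using W(1) W'(1) unfolding subgraph_def by auto
  ultimately show ?thesis using W(3) W'(3) unfolding connects_def by blast
qed

lemma sd_eq_INF: "sd U = (INF F\<in>{F. connects F U}. ereal (glen len F))"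
  unfolding steiner_dist_def connects_def by (rule arg_cong[where f = Inf]) blast

lemma sd_le: "connects F U \<Longrightarrow> sd U \<le> ereal (glen len F)"
  unfolding sd_eq_INF by (rule INF_lower) simp

lemma sd_mono: "U \<subseteq> U' \<Longrightarrow> sd U \<le> sd U'"
  unfolding steiner_dist_def by (rule Inf_superset_mono) blast

lemma glen_nonneg: "F \<subseteq> E \<Longrightarrow> 0 \<le> glen len F"
  unfolding glen_def using len_nonneg by (blast intro: sum_nonneg)

lemma glen_mono: "F \<subseteq> F' \<Longrightarrow> F' \<subseteq> E \<Longrightarrow> glen len F \<le> glen len F'"
  unfolding glen_def using len_nonneg finite_subset[OF _ finite_E] by (blast intro: sum_mono2)

lemma sd_nonneg: "0 \<le> sd U"
  unfolding sd_eq_INF by (rule INF_greatest) (simp add: glen_nonneg connects_subset)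

lemma sd_attained:
  assumes "sd U < \<infinity>"
  obtains F where "connects F U" "sd U = ereal (glen len F)"
proof -
  let ?S = "{F. connects F U}"
  have "?S \<subseteq> Pow E" using connects_subset by blast
  then have "finite ?S" using finite_E by (simp add: finite_subset)
  moreover have "?S \<noteq> {}"
  proof
    assume "?S = {}"
    with assms show False unfolding sd_eq_INF by (simp add: top_ereal_def)
  qed
  ultimately have "sd U \<in> (\<lambda>F. ereal (glen len F)) ` ?S"
    unfolding sd_eq_INF by (metis Min_Inf Min_in finite_imageI image_is_empty)
  with that show thesis by blast
qed

lemma glen_Un_le:
  assumes "F \<subseteq> E" "F' \<subseteq> E"
  shows "glen len (F \<union> F') \<le> glen len F + glen len F'"
proof -
  have "glen len (F \<union> F') + glen len (F \<inter> F') = glen len F + glen len F'"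
    unfolding glen_def using assms finite_subset[OF _ finite_E] by (simp add: sum.union_inter)
  moreover have "0 \<le> glen len (F \<inter> F')" using assms by (intro glen_nonneg) blast
  ultimately show ?thesis by linarith
qed

lemma glen_disjoint_le:
  assumes "F1 \<inter> F2 = {}" "F1 \<union> F2 \<subseteq> F - {e}" "e \<in> F" "F \<subseteq> E"
  shows "glen len F1 + (len e + glen len F2) \<le> glen len F"
proof -
  have "finite F" using assms(4) finite_E by (rule finite_subset)
  then have "finite F1" "finite F2" "e \<notin> F1 \<union> F2"
    using assms(2) by (auto intro: finite_subset)
  then have "glen len F1 + (len e + glen len F2) = glen len (insert e (F1 \<union> F2))"
    using assms(1) unfolding glen_def by (simp add: sum.union_disjoint)
  also have "\<dots> \<le> glen len F" using assms(2-4) by (intro glen_mono) auto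
  finally show ?thesis .
qed

lemma sd_union_le:
  assumes "x \<in> U" "x \<in> U'" "T \<subseteq> U \<union> U'"
  shows "sd T \<le> sd U + sd U'"
proof (cases "sd U < \<infinity> \<and> sd U' < \<infinity>")
  case True
  then obtain F F' where F: "connects F U" "sd U = ereal (glen len F)"
    "connects F' U'" "sd U' = ereal (glen len F')"
    by (metis sd_attained)
  have "sd T \<le> sd (U \<union> U')" using assms(3) by (rule sd_mono)
  also have "\<dots> \<le> ereal (glen len (F \<union> F'))"
    using connects_union[OF F(1,3) assms(1,2)] by (rule sd_le)
  also have "\<dots> \<le> sd U + sd U'"
    using glen_Un_le F connects_subset by simp
  finally show ?thesis .
next
  case False
  then show ?thesis by auto
qed

lemma sd_edge_le: "e \<in> E \<Longrightarrow> ends e = {u, v} \<Longrightarrow> sd {u, v} \<le> ereal (len e)"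
  using sd_le[OF connects_edge] by (simp add: glen_def)

lemma sd_add_edge_le:
  assumes "e \<in> E" "ends e = {u, u'}" "connects F (insert a U)" "a \<in> {u, u'}"
    and "T \<subseteq> {u, u'} \<union> insert a U"
  shows "sd T \<le> ereal (len e + glen len F)"
proof -
  have "sd T \<le> sd {u, u'} + sd (insert a U)"
    by (rule sd_union_le[of a]) (use assms(4,5) in auto)
  also have "\<dots> \<le> ereal (len e) + ereal (glen len F)"
    using sd_edge_le[OF assms(1,2)] sd_le[OF assms(3)] by (rule add_mono)
  finally show ?thesis by simp
qed

lemma sd_singleton: "v \<in> V \<Longrightarrow> sd {v} = 0"
  using sd_le[OF connects_singleton, of v] sd_nonneg[of "{v}"] by (simp add: glen_def zero_ereal_def)

section \<open>Branchings of connecting edge sets\<close>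

definition component :: "'e set \<Rightarrow> 'v \<Rightarrow> 'v set" where
  "component F u = {x. (u, x) \<in> (adj F ends)\<^sup>*}"

lemma sym_reachable: "sym ((adj F ends)\<^sup>*)"
  by (intro sym_rtrancl symI) (auto simp: adj_def insert_commute)

lemma component_eq: "x \<in> component F u \<Longrightarrow> component F x = component F u"
  unfolding component_def using symD[OF sym_reachable] by (blast intro: rtrancl_trans)

lemma connects_component:
  assumes "F \<subseteq> E" "u \<in> V"
  shows "connects {f \<in> F. ends f \<subseteq> component F u} (component F u)"
proof -
  let ?C = "component F u" and ?F = "{f \<in> F. ends f \<subseteq> component F u}"
  have reach: "(u, x) \<in> (adj ?F ends)\<^sup>* \<and> x \<in> V" if "(u, x) \<in> (adj F ends)\<^sup>*" for x
    using that
  proof (induction rule: rtrancl_induct)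
    case base
    then show ?case using assms(2) by simp
  next
    case (step x y)
    then obtain f where f: "f \<in> F" "ends f = {x, y}" unfolding adj_def by blast
    then have "f \<in> ?F"
      using step.hyps unfolding component_def by (auto intro: rtrancl_into_rtrancl)
    then have "(x, y) \<in> adj ?F ends" using f(2) unfolding adj_def by blast
    then have "(u, y) \<in> (adj ?F ends)\<^sup>*"
      using step.IH by (blast intro: rtrancl_into_rtrancl)
    moreover have "y \<in> V" using f assms(1) ends_subset by fastforce
    ultimately show ?case ..
  qed
  have "connected_graph ?C ?F ends"
    unfolding connected_graph_def
  proof (intro conjI ballI)
    show "?C \<noteq> {}" unfolding component_def by blast
    show "(x, y) \<in> (adj ?F ends)\<^sup>*" if "x \<in> ?C" "y \<in> ?C" for x y
      using that reach[of x] reach[of y] symD[OF sym_reachable]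
      unfolding component_def by (blast intro: rtrancl_trans)
  qed
  moreover have "subgraph ?C ?F V E ends"
    using assms(1) reach unfolding subgraph_def component_def by auto
  ultimately show ?thesis unfolding connects_def by blast
qed

lemma connects_in_component:
  assumes "F \<subseteq> E" "u \<in> V" "U \<subseteq> component F u"
  shows "connects {f \<in> F. ends f \<subseteq> component F u} U"
  using connects_component[OF assms(1,2)] assms(3) unfolding connects_def by blast

lemma component_remove_edge:
  assumes "ends e = {u, u'}"
  shows "component F u \<subseteq> component (F - {e}) u \<union> component (F - {e}) u'"
proof
  fix x assume "x \<in> component F u"
  then have "(u, x) \<in> (adj F ends)\<^sup>*" unfolding component_def by simp
  then show "x \<in> component (F - {e}) u \<union> component (F - {e}) u'"
  proof (induction rule: rtrancl_induct)
    case base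
    then show ?case unfolding component_def by simp
  next
    case (step x y)
    then obtain f where f: "f \<in> F" "ends f = {x, y}" unfolding adj_def by blast
    show ?case
    proof (cases "f = e")
      case True
      then have "y \<in> {u, u'}" using f(2) assms by auto
      then show ?thesis unfolding component_def by auto
    next
      case False
      then have "(x, y) \<in> adj (F - {e}) ends" using f unfolding adj_def by blast
      then show ?thesis
        using step.IH unfolding component_def by (auto intro: rtrancl_into_rtrancl)
    qed
  qed
qed

lemma connects_remove_edge:
  assumes "connects F (insert u U)" "e \<in> F" "ends e = {u, u'}"
  obtains F1 F2 U1 U2 where "connects F1 (insert u U1)" "connects F2 (insert u' U2)"
    "U1 \<union> U2 = U" "U1 \<inter> U2 = {}" "F1 \<inter> F2 = {}" "F1 \<union> F2 \<subseteq> F - {e}"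
proof -
  let ?C = "component (F - {e})"
  let ?F = "\<lambda>x. {f \<in> F - {e}. ends f \<subseteq> ?C x}"
  have FE: "F - {e} \<subseteq> E" using connects_subset[OF assms(1)] by blast
  have V: "u \<in> V" "u' \<in> V"
    using assms(2,3) connects_subset[OF assms(1)] ends_subset by fastforce+
  have self: "u \<in> ?C u" "u' \<in> ?C u'" unfolding component_def by auto
  have "U \<subseteq> component F u"
    using assms(1) unfolding connects_def connected_graph_def component_def by blast
  then have cover: "U \<subseteq> ?C u \<union> ?C u'"
    using component_remove_edge[OF assms(3)] by blast
  show thesis
  proof (cases "u' \<in> ?C u")
    case True
    then have "insert u U \<subseteq> ?C u" using cover self component_eq by blast
    then show thesis
      using that[OF connects_in_component[OF FE V(1)] connects_singleton[OF V(2)], of U]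
      by auto
  next
    case False
    then have disj: "?C u \<inter> ?C u' = {}"
      using component_eq self by blast
    have "?F u \<inter> ?F u' = {}"
      using disj ends_nonempty FE by blast
    moreover have "insert u (U \<inter> ?C u) \<subseteq> ?C u" "insert u' (U \<inter> ?C u') \<subseteq> ?C u'"
      using self by auto
    ultimately show thesis
      using that[OF connects_in_component[OF FE V(1)] connects_in_component[OF FE V(2)],
          of "U \<inter> ?C u" "U \<inter> ?C u'"] cover disj by blast
  qed
qed

lemma connects_incident_edge:
  assumes "connects F {u, x}" "x \<noteq> u"
  obtains e u' where "e \<in> F" "ends e = {u, u'}"
proof -
  have "(u, x) \<in> (adj F ends)\<^sup>*"
    using assms(1) unfolding connects_def connected_graph_def by blast
  then obtain u' where "(u, u') \<in> adj F ends"
    using assms(2) by (auto elim: converse_rtranclE)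
  then show thesis using that unfolding adj_def by blast
qed

definition branching :: "nat \<Rightarrow> 'v \<Rightarrow> 'v set \<Rightarrow> real \<Rightarrow> bool" where
  "branching k u X c \<longleftrightarrow> (\<exists>w X1 X2. X1 \<union> X2 \<subseteq> X \<and> X1 \<inter> X2 = {} \<and>
     card X1 < k \<and> card X2 < k \<and> k \<le> card (X1 \<union> X2) \<and>
     sd (insert w X1) + sd (insert w X2) + sd ({u, w} \<union> (X - (X1 \<union> X2))) \<le> ereal c)"

lemma branching_extend:
  assumes "branching k u' X' c" "sd ({u, u'} \<union> (X - X')) \<le> ereal d" "X' \<subseteq> X" "c + d \<le> c'"
  shows "branching k u X c'"
proof -
  obtain w X1 X2 where X: "X1 \<union> X2 \<subseteq> X'" "X1 \<inter> X2 = {}" "card X1 < k" "card X2 < k"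
      "k \<le> card (X1 \<union> X2)"
    and le: "sd (insert w X1) + sd (insert w X2) + sd ({u', w} \<union> (X' - (X1 \<union> X2))) \<le> ereal c"
    using assms(1) unfolding branching_def by blast
  have "sd ({u, w} \<union> (X - (X1 \<union> X2))) \<le>
      sd ({u', w} \<union> (X' - (X1 \<union> X2))) + sd ({u, u'} \<union> (X - X'))"
    by (rule sd_union_le[of u']) auto
  then have "sd (insert w X1) + sd (insert w X2) + sd ({u, w} \<union> (X - (X1 \<union> X2))) \<le>
      (sd (insert w X1) + sd (insert w X2) + sd ({u', w} \<union> (X' - (X1 \<union> X2)))) +
      sd ({u, u'} \<union> (X - X'))"
    by (simp add: add.assoc add_left_mono)
  also have "\<dots> \<le> ereal c + ereal d" using le assms(2) by (rule add_mono)
  also have "\<dots> \<le> ereal c'" using assms(4) by simp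
  finally show ?thesis
    using X assms(3) unfolding branching_def by (intro exI[of _ w] exI[of _ X1] exI[of _ X2]) auto
qed

lemma branching_here:
  assumes "sd (insert u X1) \<le> ereal c1" "sd (insert u X2) \<le> ereal c2" "c1 + c2 \<le> c" "u \<in> V"
    and "X1 \<inter> X2 = {}" "card X1 < k" "card X2 < k" "k \<le> card (X1 \<union> X2)"
  shows "branching k u (X1 \<union> X2) c"
proof -
  have "sd ({u, u} \<union> (X1 \<union> X2 - (X1 \<union> X2))) = 0"
    using sd_singleton[OF assms(4)] by simp
  then have "sd (insert u X1) + sd (insert u X2) + sd ({u, u} \<union> (X1 \<union> X2 - (X1 \<union> X2)))
      \<le> ereal c1 + ereal c2"
    using add_mono[OF assms(1,2)] by simp
  also have "\<dots> \<le> ereal c" using assms(3) by simp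
  finally show ?thesis
    using assms(5-8) unfolding branching_def
    by (intro exI[of _ u] exI[of _ X1] exI[of _ X2]) auto
qed

text \<open>Walk away from \<open>u\<close> as long as a single edge leads to \<open>k\<close> elements of \<open>X\<close>.\<close>

lemma connects_imp_branching:
  assumes "connects F (insert u X)" "2 \<le> k" "k \<le> card X"
  shows "branching k u X (glen len F)"
  using connects_finite[OF assms(1)] assms(1,3)
proof (induction F arbitrary: u X rule: finite_psubset_induct)
  case (psubset F)
  have "\<not> X \<subseteq> {u}" using psubset.prems(2) assms(2) card_mono[of "{u}" X] by auto
  then obtain x where x: "x \<in> X" "x \<noteq> u" by blast
  have "connects F {u, x}"
    using psubset.prems(1) x(1) unfolding connects_def by blast
  then obtain e u' where e: "e \<in> F" "ends e = {u, u'}"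
    using connects_incident_edge x(2) by blast
  obtain F1 F2 X1 X2 where F1: "connects F1 (insert u X1)" and F2: "connects F2 (insert u' X2)"
    and X: "X1 \<union> X2 = X" "X1 \<inter> X2 = {}" and F: "F1 \<inter> F2 = {}" "F1 \<union> F2 \<subseteq> F - {e}"
    using connects_remove_edge[OF psubset.prems(1) e] .
  have FE: "F \<subseteq> E" using psubset.prems(1) by (rule connects_subset)
  then have "e \<in> E" using e(1) by blast
  note detour = sd_add_edge_le[OF \<open>e \<in> E\<close> e(2)]
  have total: "glen len F1 + (len e + glen len F2) \<le> glen len F"
    using F e(1) FE by (rule glen_disjoint_le)
  have sub: "F1 \<subset> F" "F2 \<subset> F" using F(2) e(1) by auto
  consider "k \<le> card X1" | "k \<le> card X2" | "card X1 < k" "card X2 < k" by linarith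
  then show ?case
  proof cases
    case 1
    have "sd ({u, u} \<union> (X - X1)) \<le> ereal (len e + glen len F2)"
      by (rule detour[OF F2]) (use X(1) in auto)
    with psubset.IH[OF sub(1) F1 1] show ?thesis
      by (rule branching_extend) (use X(1) total in auto)
  next
    case 2
    have "sd ({u, u'} \<union> (X - X2)) \<le> ereal (len e + glen len F1)"
      by (rule detour[OF F1]) (use X(1) in auto)
    with psubset.IH[OF sub(2) F2 2] show ?thesis
      by (rule branching_extend) (use X(1) total in auto)
  next
    case 3
    have "sd (insert u X2) \<le> ereal (len e + glen len F2)"
      by (rule detour[OF F2]) auto
    moreover have "u \<in> V" using connects_vertices[OF F1] by blast
    ultimately have "branching k u (X1 \<union> X2) (glen len F)"
      using sd_le[OF F1] total X 3 psubset.prems(2) by (intro branching_here) auto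
    then show ?thesis unfolding X(1) .
  qed
qed

lemma sd_branching:
  assumes "sd (insert u X) \<le> ereal c" "2 \<le> k" "k \<le> card X"
  shows "branching k u X c"
proof -
  have "sd (insert u X) < \<infinity>" using assms(1) by auto
  then obtain F where F: "connects F (insert u X)" "sd (insert u X) = ereal (glen len F)"
    by (rule sd_attained)
  have "branching k u X (glen len F)"
    using F(1) assms(2,3) by (rule connects_imp_branching)
  moreover have "ereal (glen len F) \<le> ereal c" using F(2) assms(1) by simp
  ultimately show ?thesis unfolding branching_def by (blast intro: order_trans)
qed

lemma sd_H_shape:
  assumes "7 \<le> card A" "sd A < \<infinity>"
  obtains w z X1 X2 Y1 Y2 where "A = X1 \<union> X2 \<union> Y1 \<union> Y2"
    "X1 \<inter> X2 = {}" "Y1 \<inter> Y2 = {}" "(X1 \<union> X2) \<inter> (Y1 \<union> Y2) = {}"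
    "{} \<notin> {X1, X2, Y1, Y2}" "3 \<le> card (X1 \<union> X2)" "3 \<le> card (Y1 \<union> Y2)"
    "sd (insert w X1) + sd (insert w X2) + (sd (insert z Y1) + sd (insert z Y2) + sd {w, z}) \<le> sd A"
proof -
  have fin: "finite A" using assms(1) by (metis card.infinite not_numeral_le_zero)
  obtain u where u: "u \<in> A" using assms(1) by fastforce
  obtain c where c: "sd A = ereal c" using assms(2) sd_nonneg[of A] by (cases "sd A") auto
  have "branching 3 u A c" using assms(1) c u by (intro sd_branching) (auto simp: insert_absorb)
  then obtain w X1 X2 where X: "X1 \<union> X2 \<subseteq> A" "X1 \<inter> X2 = {}" "card X1 < 3" "card X2 < 3"
      "3 \<le> card (X1 \<union> X2)"
    and cX: "sd (insert w X1) + sd (insert w X2) + sd ({u, w} \<union> (A - (X1 \<union> X2))) \<le> ereal c"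
    unfolding branching_def by blast
  define Y where "Y = A - (X1 \<union> X2)"
  have "card A - card (X1 \<union> X2) \<le> card Y"
    unfolding Y_def using finite_subset[OF X(1) fin] by (rule diff_card_le_card_Diff)
  moreover have "card (X1 \<union> X2) \<le> 4" using card_Un_le[of X1 X2] X(3,4) by linarith
  ultimately have card_Y: "3 \<le> card Y" using assms(1) by linarith
  have le_Y: "sd (insert w Y) \<le> sd ({u, w} \<union> Y)" by (rule sd_mono) blast
  have "sd ({u, w} \<union> Y) \<noteq> \<infinity>" using cX unfolding Y_def by auto
  then obtain d where d: "sd (insert w Y) = ereal d"
    using le_Y sd_nonneg[of "insert w Y"] by (cases "sd (insert w Y)") auto
  have "branching (card Y) w Y d" using card_Y d by (intro sd_branching) auto
  then obtain z Y1 Y2 where Y: "Y1 \<union> Y2 \<subseteq> Y" "Y1 \<inter> Y2 = {}" "card Y1 < card Y" "card Y2 < card Y"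
      "card Y \<le> card (Y1 \<union> Y2)"
    and cY: "sd (insert z Y1) + sd (insert z Y2) + sd ({w, z} \<union> (Y - (Y1 \<union> Y2))) \<le> ereal d"
    unfolding branching_def by blast
  have "finite Y" using fin unfolding Y_def by simp
  then have YY: "Y1 \<union> Y2 = Y" using Y(1,5) by (rule card_seteq)
  have "sd (insert z Y1) + sd (insert z Y2) + sd {w, z} \<le> sd ({u, w} \<union> Y)"
    using cY le_Y YY d by simp
  from add_left_mono[OF this]
  have "sd (insert w X1) + sd (insert w X2) + (sd (insert z Y1) + sd (insert z Y2) + sd {w, z})
      \<le> sd A"
    by (rule order_trans) (use cX c in \<open>simp add: Y_def\<close>)
  moreover have "X1 \<noteq> {}" "X2 \<noteq> {}" "Y1 \<noteq> {}" "Y2 \<noteq> {}" using X(3-5) Y(3-5) by auto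
  moreover have "A = X1 \<union> X2 \<union> Y1 \<union> Y2" "(X1 \<union> X2) \<inter> (Y1 \<union> Y2) = {}"
    using X(1) YY unfolding Y_def by auto
  ultimately show thesis using that[of X1 X2 Y1 Y2 w z] X(2,5) Y(2) YY card_Y by blast
qed

abbreviation rsd :: "'v set \<Rightarrow> real" where
  "rsd U \<equiv> real_of_ereal (sd U)"

lemma ereal_rsd: "sd U < \<infinity> \<Longrightarrow> ereal (rsd U) = sd U"
  using sd_nonneg[of U] by (cases "sd U") auto

lemma rsd_le: "sd U \<le> ereal c \<Longrightarrow> rsd U \<le> c"
  using sd_nonneg[of U] by (cases "sd U") auto

lemma sd_join_le:
  assumes "sd (insert w S) \<le> ereal s" "sd (insert w T) \<le> ereal t"
  shows "sd (insert w (S \<union> T)) \<le> ereal (s + t)"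
proof -
  have "sd (insert w (S \<union> T)) \<le> sd (insert w S) + sd (insert w T)"
    by (rule sd_union_le[of w]) auto
  also have "\<dots> \<le> ereal s + ereal t" using assms by (rule add_mono)
  finally show ?thesis by simp
qed

lemma rsd_part_le: "sd (insert w S) \<le> ereal s \<Longrightarrow> rsd S \<le> s"
  using sd_mono[of S "insert w S"] by (intro rsd_le) (auto intro: order_trans)

lemma rsd_through_le:
  assumes "sd (insert w S) \<le> ereal s" "sd {w, z} \<le> ereal q" "sd (insert z T) \<le> ereal t"
  shows "rsd (S \<union> T) \<le> s + q + t"
proof (rule rsd_part_le)
  have "sd (insert z S) \<le> sd (insert w (S \<union> {z}))" by (rule sd_mono) blast
  also have "\<dots> \<le> ereal (s + q)" using assms(1,2) by (rule sd_join_le)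
  finally show "sd (insert z (S \<union> T)) \<le> ereal (s + q + t)" using assms(3) by (rule sd_join_le)
qed

lemma sd_H_split:
  assumes "7 \<le> card A" "sd A < \<infinity>"
  obtains X1 X2 Y1 Y2 where "H_split rsd A X1 X2 Y1 Y2"
proof -
  obtain w z X1 X2 Y1 Y2 where A: "A = X1 \<union> X2 \<union> Y1 \<union> Y2"
    and disj: "X1 \<inter> X2 = {}" "Y1 \<inter> Y2 = {}" "(X1 \<union> X2) \<inter> (Y1 \<union> Y2) = {}"
    and size: "{} \<notin> {X1, X2, Y1, Y2}" "3 \<le> card (X1 \<union> X2)" "3 \<le> card (Y1 \<union> Y2)"
    and le: "sd (insert w X1) + sd (insert w X2) + (sd (insert z Y1) + sd (insert z Y2) + sd {w, z})
      \<le> sd A"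
    using sd_H_shape[OF assms] by metis
  define x1 x2 y1 y2 q where lengths: "x1 = rsd (insert w X1)" "x2 = rsd (insert w X2)"
    "y1 = rsd (insert z Y1)" "y2 = rsd (insert z Y2)" "q = rsd {w, z}"
  have "sd (insert w X1) + sd (insert w X2) + (sd (insert z Y1) + sd (insert z Y2) + sd {w, z}) \<noteq> \<infinity>"
    using le assms(2) by auto
  then have sd: "sd (insert w X1) = ereal x1" "sd (insert w X2) = ereal x2"
    "sd (insert z Y1) = ereal y1" "sd (insert z Y2) = ereal y2" "sd {w, z} = ereal q"
    unfolding lengths by (auto simp: ereal_rsd)
  have total: "x1 + x2 + (y1 + y2 + q) \<le> rsd A"
    using le ereal_rsd[OF assms(2)] unfolding sd by (metis ereal_less_eq(3) plus_ereal.simps(1))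
  note parts = sd[THEN eq_refl]
  note X = sd_join_le[OF parts(1,2)] and Y = sd_join_le[OF parts(3,4)]
  note through = rsd_through_le[OF _ parts(5)]
  have compl: "A - X1 = X2 \<union> (Y1 \<union> Y2)" "A - X2 = X1 \<union> (Y1 \<union> Y2)"
    "A - Y1 = X1 \<union> X2 \<union> Y2" "A - Y2 = X1 \<union> X2 \<union> Y1" "A - (X1 \<union> X2) = Y1 \<union> Y2"
    using A disj by blast+
  have "0 \<le> q" using sd_nonneg[of "{w, z}"] by (simp add: sd)
  then have "\<forall>Z\<in>{X1, X2, Y1, Y2, X1 \<union> X2}. rsd Z + rsd (A - Z) \<le> rsd A"
    using total rsd_part_le[OF X] rsd_part_le[OF Y] parts(1-4)[THEN rsd_part_le]
      through[OF parts(2) Y] through[OF parts(1) Y] through[OF X parts(4)] through[OF X parts(3)]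
    by (auto simp: compl)
  moreover have
    "rsd (X1 \<union> X2) + rsd (Y1 \<union> Y2) + rsd (X1 \<union> Y1) + rsd (X2 \<union> Y2) \<le> 2 * rsd A"
    "rsd (X1 \<union> X2) + rsd (Y1 \<union> Y2) + rsd (X1 \<union> Y2) + rsd (X2 \<union> Y1) \<le> 2 * rsd A"
    using total rsd_part_le[OF X] rsd_part_le[OF Y] through[OF parts(1,3)] through[OF parts(2,4)]
      through[OF parts(1,4)] through[OF parts(2,3)] by linarith+
  ultimately show thesis using that A disj size unfolding H_split_def by blast
qed

end

section \<open>Arcs of a weighted circle\<close>

text \<open>The positions on the circle are the natural numbers modulo \<open>n\<close>, so that an arc is the image
  of an interval even if it passes the origin. The step from position \<open>i\<close> to \<open>Suc i\<close> has length
  \<open>wt i\<close>.\<close>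

locale weighted_circle =
  fixes v :: "nat \<Rightarrow> 'v" and n :: nat and wt :: "nat \<Rightarrow> real"
  assumes n_pos: "0 < n" and v_eq_iff: "v i = v j \<longleftrightarrow> i mod n = j mod n"
    and wt_cong: "v i = v j \<Longrightarrow> wt i = wt j" and wt_nonneg: "0 \<le> wt i"
begin

definition pos :: "nat \<Rightarrow> real" where
  "pos i = (\<Sum>j<i. wt j)"

lemma sum_wt_eq: "p \<le> r \<Longrightarrow> (\<Sum>j\<in>{p..<r}. wt j) = pos r - pos p"
  unfolding pos_def using sum.atLeastLessThan_concat[of 0 p r wt] by (simp add: lessThan_atLeast0)

lemma pos_mono: "i \<le> j \<Longrightarrow> pos i \<le> pos j"
  unfolding pos_def by (rule sum_mono2) (auto intro: wt_nonneg)

lemma v_add_period [simp]: "v (i + n) = v i"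
  by (simp add: v_eq_iff)

lemma v_add_cong: "v i = v j \<Longrightarrow> v (i + d) = v (j + d)"
  unfolding v_eq_iff by (rule mod_add_cong) simp_all

lemma image_v_translate:
  assumes "v i = v j"
  shows "v ` {i..i + d} = v ` {j..j + d}"
proof -
  have "v ` {i..i + d} = (\<lambda>k. v (i + k)) ` {..d}" for i
    by (auto simp: image_iff) (metis atMost_iff le_add_diff_inverse nat_add_left_cancel_le)
  then show ?thesis using v_add_cong[OF assms] by simp
qed

lemma pos_translate:
  assumes "v i = v j"
  shows "pos (i + d) - pos i = pos (j + d) - pos j"
proof (induction d)
  case (Suc d)
  have "wt (i + d) = wt (j + d)" by (intro wt_cong v_add_cong assms)
  with Suc show ?case by (simp add: pos_def)
qed simp

lemma pos_add_period: "pos (i + n) = pos i + pos n"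
  using pos_translate[of n 0 i] by (simp add: pos_def add.commute v_eq_iff)

lemma v_neq_in_window:
  assumes "i < j" "j < i + n"
  shows "v i \<noteq> v j"
proof
  assume "v i = v j"
  then have "n dvd j - i" using assms(1) unfolding v_eq_iff by (metis less_imp_le mod_eq_dvd_iff_nat)
  then have "n \<le> j - i" using assms(1) by (intro dvd_imp_le) auto
  then show False using assms by simp
qed

lemma ex_in_window: "\<exists>i. k \<le> i \<and> i < k + n \<and> v i = v j"
proof (intro exI conjI)
  let ?i = "k + (j + (n * k - k)) mod n"
  show "k \<le> ?i" "?i < k + n" using n_pos by auto
  have "k \<le> n * k" using n_pos by simp
  then have "k + (j + (n * k - k)) = j + n * k" by linarith
  then show "v ?i = v j" unfolding v_eq_iff by (metis mod_add_right_eq mod_mult_self2)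
qed

definition arc_cover :: "'v set \<Rightarrow> real \<Rightarrow> bool" where
  "arc_cover U c \<longleftrightarrow> (\<exists>p r. p \<le> r \<and> U \<subseteq> v ` {p..r} \<and> pos r - pos p \<le> c)"

definition arc_hull :: "'v set \<Rightarrow> nat \<Rightarrow> nat \<Rightarrow> bool" where
  "arc_hull U p r \<longleftrightarrow> p \<le> r \<and> r < p + n \<and> v p \<in> U \<and> v r \<in> U \<and> U \<subseteq> v ` {p..r}"

lemma arc_hullD:
  assumes "arc_hull U p r"
  shows "p \<le> r" "r < p + n" "v p \<in> U" "v r \<in> U" "U \<subseteq> v ` {p..r}"
  using assms unfolding arc_hull_def by auto

lemma window_arc_hull:
  assumes "U \<subseteq> range v" "U \<noteq> {}"
  obtains p r where "k \<le> p" "r < k + n" "arc_hull U p r"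
proof -
  define I where "I = {i \<in> {k..<k + n}. v i \<in> U}"
  then have I_iff: "i \<in> I \<longleftrightarrow> k \<le> i \<and> i < k + n \<and> v i \<in> U" for i by auto
  have "\<exists>i\<in>I. x = v i" if x: "x \<in> U" for x
  proof -
    obtain j where "x = v j" using x assms(1) by blast
    then show ?thesis using ex_in_window[of k j] x I_iff by metis
  qed
  then have cover: "U \<subseteq> v ` I" by blast
  have I: "finite I" "I \<noteq> {}" using cover assms(2) unfolding I_def by auto
  have "I \<subseteq> {Min I..Max I}" using I by (intro subsetI) simp
  then have "U \<subseteq> v ` {Min I..Max I}" using cover by blast
  moreover have ends: "k \<le> Min I" "Max I < k + n" "v (Min I) \<in> U" "v (Max I) \<in> U"
    using Min_in[OF I] Max_in[OF I] by (simp_all add: I_iff)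
  moreover have "Min I \<le> Max I" using I by simp
  ultimately have "arc_hull U (Min I) (Max I)" unfolding arc_hull_def by simp
  then show thesis using that ends(1,2) by blast
qed

lemma arc_hull_translate:
  assumes "v i = v p" "arc_hull U p r"
  shows "arc_hull U i (i + (r - p))"
proof -
  note hull = arc_hullD[OF assms(2)]
  have "v (i + (r - p)) = v r" "v ` {i..i + (r - p)} = v ` {p..r}"
    using v_add_cong[OF assms(1), of "r - p"] image_v_translate[OF assms(1), of "r - p"] hull(1)
    by simp_all
  then show ?thesis unfolding arc_hull_def using hull assms(1) by auto
qed

lemma arc_hull_add_period:
  assumes "arc_hull U p r"
  shows "arc_hull U (p + n) (r + n)"
proof -
  have "p + n + (r - p) = r + n" using arc_hullD(1)[OF assms] by simp
  then show ?thesis using arc_hull_translate[OF v_add_period assms] by metis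
qed

lemma arc_hull_Un:
  assumes "arc_hull U p r" "arc_hull U' q s" "r \<le> q" "s < p + n"
  shows "arc_hull (U \<union> U') p s"
proof -
  note hulls = arc_hullD[OF assms(1)] arc_hullD[OF assms(2)]
  have "{p..r} \<union> {q..s} \<subseteq> {p..s}" using hulls(1,6) assms(3) by auto
  then have "U \<union> U' \<subseteq> v ` {p..s}" using hulls(5,10) by blast
  then show ?thesis unfolding arc_hull_def using hulls assms(3,4) by auto
qed

lemma arc_cover_arc_hull:
  assumes "arc_cover U c" "U \<noteq> {}"
  obtains p r where "k \<le> p" "p < k + n" "arc_hull U p r" "pos r - pos p \<le> c"
proof -
  obtain p0 r0 where arc: "p0 \<le> r0" "U \<subseteq> v ` {p0..r0}" "pos r0 - pos p0 \<le> c"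
    using assms(1) unfolding arc_cover_def by blast
  obtain p r where hull: "p0 \<le> p" "r < p0 + n" "arc_hull U p r"
    using window_arc_hull[of U] arc(2) assms(2) by blast
  have pr: "p \<le> r" "v r \<in> U" using arc_hullD[OF hull(3)] by auto
  then obtain i where i: "p0 \<le> i" "i \<le> r0" "v r = v i" using arc(2) by fastforce
  have "r \<le> r0"
  proof (rule ccontr)
    assume "\<not> r \<le> r0"
    then show False using v_neq_in_window[of i r] i hull(2) by simp
  qed
  then have len: "pos r - pos p \<le> c" using arc(3) pos_mono[of p0 p] pos_mono[of r r0] hull(1) by simp
  obtain i where i: "k \<le> i" "i < k + n" "v i = v p" using ex_in_window by blast
  have "pos (i + (r - p)) - pos i = pos r - pos p"
    using pos_translate[OF i(3), of "r - p"] pr(1) by simp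
  then show thesis using that[OF i(1,2) arc_hull_translate[OF i(3) hull(3)]] len by simp
qed

lemma subarc_translate:
  assumes "v i = v k" "p \<le> k" "k + (j - i) \<le> r" "i \<le> j"
  shows "v ` {i..j} \<subseteq> v ` {p..r}" "pos j - pos i \<le> pos r - pos p"
proof -
  have j: "i + (j - i) = j" using assms(4) by simp
  have "v ` {i..j} = v ` {k..k + (j - i)}"
    using image_v_translate[OF assms(1), of "j - i"] unfolding j .
  also have "\<dots> \<subseteq> v ` {p..r}" using assms(2,3) by (intro image_mono) auto
  finally show "v ` {i..j} \<subseteq> v ` {p..r}" .
  have "pos j - pos i = pos (k + (j - i)) - pos k"
    using pos_translate[OF assms(1), of "j - i"] unfolding j .
  then show "pos j - pos i \<le> pos r - pos p"
    using pos_mono[OF assms(2)] pos_mono[OF assms(3)] by simp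
qed

lemma arc_through_two_points:
  assumes "v i \<in> v ` {p..r}" "v j \<in> v ` {p..r}" "i \<le> j" "j < i + n"
  obtains "v ` {i..j} \<subseteq> v ` {p..r}" "pos j - pos i \<le> pos r - pos p"
  | "v ` {j..i + n} \<subseteq> v ` {p..r}" "pos (i + n) - pos j \<le> pos r - pos p"
proof -
  obtain k l where k: "p \<le> k" "k \<le> r" "v i = v k" and l: "p \<le> l" "l \<le> r" "v j = v l"
    using assms(1,2) by auto
  show thesis
  proof (cases "k \<le> l")
    case True
    have "k + (j - i) \<le> l"
    proof (rule ccontr)
      assume "\<not> k + (j - i) \<le> l"
      then have "v l \<noteq> v (k + (j - i))" using True assms(3,4) by (intro v_neq_in_window) linarith+
      then show False using v_add_cong[OF k(3), of "j - i"] assms(3) l(3) by simp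
    qed
    then show thesis using that(1) subarc_translate[OF k(3,1)] l(2) assms(3) by simp
  next
    case False
    have "l + (i + n - j) \<le> k"
    proof (rule ccontr)
      assume "\<not> l + (i + n - j) \<le> k"
      then have "v k \<noteq> v (l + (i + n - j))" using False assms(3) by (intro v_neq_in_window) linarith+
      then show False using v_add_cong[OF l(3), of "i + n - j"] assms(4) k(3) by simp
    qed
    then show thesis using that(2) subarc_translate[OF l(3,1)] k(2) assms(4) by simp
  qed
qed

end

section \<open>Critical sets\<close>

text \<open>A minimal counterexample \<open>A\<close>, with \<open>f\<close> the Steiner distance in the graph.\<close>

locale critical_set = weighted_circle v n wt
  for v :: "nat \<Rightarrow> 'v" and n :: nat and wt :: "nat \<Rightarrow> real" +
  fixes f :: "'v set \<Rightarrow> real" and A :: "'v set"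
  assumes A_range: "A \<subseteq> range v" and not_covered: "\<not> arc_cover A (f A)"
    and covered_subset: "B \<subset> A \<Longrightarrow> arc_cover B (f B)"
    and f_mono: "B \<subset> A \<Longrightarrow> f B \<le> f A"
begin

lemma covering_arc_long: "p \<le> r \<Longrightarrow> A \<subseteq> v ` {p..r} \<Longrightarrow> f A < pos r - pos p"
  using not_covered unfolding arc_cover_def by (meson not_le)

lemma arc_hulls_meet_long:
  assumes "arc_hull B p r" "arc_hull B' q s" "B \<union> B' = A" "p \<le> q" "q \<le> r"
  shows "f A < (pos r - pos p) + (pos s - pos q)"
proof -
  note hulls = arc_hullD[OF assms(1)] arc_hullD[OF assms(2)]
  have "q \<le> s" by (rule hulls(6))
  have "{p..r} \<union> {q..s} \<subseteq> {p..max r s}" using assms(4) by auto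
  then have "A \<subseteq> v ` {p..max r s}" using hulls(5,10) assms(3) by blast
  then have "f A < pos (max r s) - pos p"
    using hulls(1) by (intro covering_arc_long) auto
  also have "\<dots> \<le> (pos r - pos p) + (pos s - pos q)"
    using pos_mono[OF \<open>q \<le> s\<close>] pos_mono[OF \<open>q \<le> r\<close>] by (auto simp: max_def)
  finally show ?thesis .
qed

lemma disjoint_arc_hulls:
  assumes "Z \<subset> A" "Z \<noteq> {}" "f Z + f (A - Z) \<le> f A"
  obtains p r q s where "arc_hull Z p r" "arc_hull (A - Z) q s" "r < q" "s < p + n"
    "pos r - pos p \<le> f Z" "pos s - pos q \<le> f (A - Z)"
proof -
  have Z': "A - Z \<subset> A" "A - Z \<noteq> {}" "Z \<union> (A - Z) = A" "(A - Z) \<union> Z = A" using assms(1,2) by auto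
  obtain p r where Z: "arc_hull Z p r" "pos r - pos p \<le> f Z"
    using arc_cover_arc_hull[OF covered_subset[OF assms(1)] assms(2)] by metis
  obtain q s where qs: "p \<le> q" "q < p + n" "arc_hull (A - Z) q s" "pos s - pos q \<le> f (A - Z)"
    using arc_cover_arc_hull[OF covered_subset[OF Z'(1)] Z'(2)] by metis
  have "\<not> q \<le> r"
    using arc_hulls_meet_long[OF Z(1) qs(3) Z'(3) qs(1)] Z(2) qs(4) assms(3) by auto
  moreover have "\<not> p + n \<le> s"
    using arc_hulls_meet_long[OF qs(3) arc_hull_add_period[OF Z(1)] Z'(4)] qs(2,4) Z(2) assms(3)
    by (auto simp: pos_add_period)
  ultimately show thesis using that[OF Z(1) qs(3)] Z(2) qs(4) by simp
qed

lemma not_crossing: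
  assumes Z: "Z \<subset> A" "f Z + f (A - Z) \<le> f A"
    and ord: "i < j" "j < k" "k < l" "l < i + n"
    and mem: "v i \<in> Z" "v j \<in> A - Z" "v k \<in> Z" "v l \<in> A - Z"
  shows False
proof -
  have "Z \<noteq> {}" using mem(1) by blast
  then obtain p r q s where hulls: "arc_hull Z p r" "arc_hull (A - Z) q s" and "r < q" "s < p + n"
    using disjoint_arc_hulls[OF Z(1) _ Z(2)] by metis
  note arcs = arc_hullD(5)[OF hulls(1)] arc_hullD(5)[OF hulls(2)]
  have "v a \<noteq> v b" if "a \<in> {p..r}" "b \<in> {q..s}" for a b
    using that \<open>r < q\<close> \<open>s < p + n\<close> by (intro v_neq_in_window) auto
  then have "v ` {p..r} \<inter> v ` {q..s} = {}" by blast
  moreover have "v j \<in> v ` {p..r} \<or> v l \<in> v ` {p..r}"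
  proof (rule arc_through_two_points[of i p r k])
    show "v i \<in> v ` {p..r}" "v k \<in> v ` {p..r}" using arcs(1) mem(1,3) by auto
    assume "v ` {i..k} \<subseteq> v ` {p..r}"
    then show ?thesis using ord(1,2) by auto
  next
    assume "v ` {k..i + n} \<subseteq> v ` {p..r}"
    then have "v l \<in> v ` {p..r}" using ord(3,4) by auto
    then show ?thesis ..
  qed (use ord in auto)
  ultimately show False using arcs(2) mem by blast
qed

definition in_order :: "nat \<Rightarrow> nat \<Rightarrow> 'v set \<Rightarrow> 'v set \<Rightarrow> bool" where
  "in_order p r Z Z' \<longleftrightarrow>
     (\<exists>a0 a1 b0 b1. p \<le> a0 \<and> a1 < b0 \<and> b1 \<le> r \<and> arc_hull Z a0 a1 \<and> arc_hull Z' b0 b1)"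

lemma in_order_linear:
  assumes Z: "Z \<union> Z' \<subset> A" "Z \<inter> Z' = {}" "Z \<noteq> {}" "Z' \<noteq> {}"
    and cheap: "f Z + f (A - Z) \<le> f A" "f Z' + f (A - Z') \<le> f A"
    and hull: "arc_hull (Z \<union> Z') p r"
    and y: "v y \<in> A - (Z \<union> Z')" "r < y" "y < p + n"
  shows "in_order p r Z Z' \<or> in_order p r Z' Z"
proof -
  have "Z \<subseteq> range v" "Z' \<subseteq> range v" using Z(1) A_range by blast+
  then obtain a0 a1 b0 b1 where a: "p \<le> a0" "a1 < p + n" "arc_hull Z a0 a1"
    and b: "p \<le> b0" "b1 < p + n" "arc_hull Z' b0 b1"
    using window_arc_hull Z(3,4) by metis
  have le_r: "i \<le> r" if i: "v i \<in> Z \<union> Z'" "i < p + n" for i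
  proof (rule ccontr)
    assume "\<not> i \<le> r"
    obtain j where "p \<le> j" "j \<le> r" "v i = v j" using i(1) arc_hullD(5)[OF hull] by fastforce
    then show False using v_neq_in_window[of j i] \<open>\<not> i \<le> r\<close> i(2) by simp
  qed
  have mem: "v a0 \<in> Z" "v a1 \<in> Z" "v b0 \<in> Z'" "v b1 \<in> Z'"
    using arc_hullD[OF a(3)] arc_hullD[OF b(3)] by blast+
  have le: "a1 \<le> r" "b1 \<le> r" using le_r mem a(2) b(2) by auto
  have neq: "i \<noteq> j" if "v i \<in> Z" "v j \<in> Z'" for i j using that Z(2) by auto
  have psub: "Z \<subset> A" "Z' \<subset> A" using Z(1) by auto
  have compl: "v b0 \<in> A - Z" "v a0 \<in> A - Z'" "v y \<in> A - Z" "v y \<in> A - Z'"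
    using mem Z(2) psub y(1) by auto
  have "\<not> (a0 < b0 \<and> b0 < a1)"
    using not_crossing[OF psub(1) cheap(1), of a0 b0 a1 y] mem(1,2) compl y(2,3) a(1) le by auto
  moreover have "\<not> (b0 < a0 \<and> a0 < b1)"
    using not_crossing[OF psub(2) cheap(2), of b0 a0 b1 y] mem(3,4) compl y(2,3) b(1) le by auto
  moreover have "a0 \<noteq> b0" "a0 \<noteq> b1" "a1 \<noteq> b0" using neq mem by auto
  ultimately have "a1 < b0 \<or> b1 < a0" by linarith
  then show ?thesis unfolding in_order_def using a b le by blast
qed

text \<open>This is where at least three elements on either side of the split are needed: dropping one
  in the middle of a hull forces the rest of \<open>A\<close> onto an arc around the other way.\<close>

lemma arc_hull_wide:
  assumes "arc_hull U p r" "U \<subseteq> A" "3 \<le> card U"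
  shows "pos n - f A \<le> pos r - pos p"
proof -
  have "\<not> U \<subseteq> {v p, v r}"
    using card_mono[of "{v p, v r}" U] assms(3) by (auto simp: card_insert_if split: if_splits)
  then obtain i where i: "p \<le> i" "i \<le> r" "v i \<in> U" "v i \<noteq> v p" "v i \<noteq> v r"
    using arc_hullD(5)[OF assms(1)] by fastforce
  let ?B = "A - {v i}"
  have B: "?B \<subset> A" using i(3) assms(2) by blast
  obtain q s where qs: "q \<le> s" "?B \<subseteq> v ` {q..s}" "pos s - pos q \<le> f ?B"
    using covered_subset[OF B] unfolding arc_cover_def by blast
  have "v i \<notin> v ` {q..s}"
    using covering_arc_long[OF qs(1)] qs(2,3) f_mono[OF B] by fastforce
  moreover have "v i \<in> v ` {p..r}" using i(1,2) by simp
  moreover have "v p \<in> v ` {q..s}" "v r \<in> v ` {q..s}" "p \<le> r" "r < p + n"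
    using qs(2) arc_hullD[OF assms(1)] assms(2) i(4,5) by auto
  ultimately have "pos (p + n) - pos r \<le> pos s - pos q"
    using arc_through_two_points[of p q s r] by blast
  then show ?thesis using qs(3) f_mono[OF B] by (simp add: pos_add_period)
qed

lemma crossing_pair_long:
  assumes hulls: "arc_hull P a0 a1" "arc_hull Q b0 b1" "arc_hull P' c0 c1" "arc_hull Q' d0 d1"
    and ord: "a1 < b0" "b1 < c0" "c1 < d0" "d1 < a0 + n"
    and A: "P \<union> Q \<union> P' \<union> Q' = A" and proper: "P \<union> P' \<subset> A"
  shows "pos c1 - pos a0 \<le> f (P \<union> P') \<or> pos (a1 + n) - pos c0 \<le> f (P \<union> P')"
proof (rule ccontr)
  assume neg: "\<not> ?thesis"
  obtain p r where pr: "p \<le> r" "P \<union> P' \<subseteq> v ` {p..r}" "pos r - pos p \<le> f (P \<union> P')"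
    using covered_subset[OF proper] unfolding arc_cover_def by blast
  note le = hulls[THEN arc_hullD(1)]
  have ends: "v a0 \<in> v ` {p..r}" "v a1 \<in> v ` {p..r}" "v c0 \<in> v ` {p..r}" "v c1 \<in> v ` {p..r}"
    using arc_hullD(3,4)[OF hulls(1)] arc_hullD(3,4)[OF hulls(3)] pr(2) by blast+
  have "Q \<subseteq> v ` {b0..b1}" by (rule arc_hullD(5)[OF hulls(2)])
  also have "\<dots> \<subseteq> v ` {a1..c0}" using ord le by (intro image_mono) auto
  also have "\<dots> \<subseteq> v ` {p..r}"
    by (rule arc_through_two_points[OF ends(2,3)]) (use neg pr(3) le ord in auto)
  finally have Q: "Q \<subseteq> v ` {p..r}" .
  have "Q' \<subseteq> v ` {d0..d1}" by (rule arc_hullD(5)[OF hulls(4)])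
  also have "\<dots> \<subseteq> v ` {c1..a0 + n}" using ord le by (intro image_mono) auto
  also have "\<dots> \<subseteq> v ` {p..r}"
    by (rule arc_through_two_points[OF ends(1,4)]) (use neg pr(3) le ord in auto)
  finally have "A \<subseteq> v ` {p..r}" unfolding A[symmetric] using Q pr(2) by simp
  then show False using covering_arc_long[OF pr(1)] pr(3) f_mono[OF proper] by simp
qed

lemma cyclic_arc_hulls_long:
  assumes hulls: "arc_hull P a0 a1" "arc_hull Q b0 b1" "arc_hull P' c0 c1" "arc_hull Q' d0 d1"
    and ord: "a1 < b0" "b1 < c0" "c1 < d0" "d1 < a0 + n"
    and A: "P \<union> Q \<union> P' \<union> Q' = A"
  shows "f A < pos d1 - pos a0"
proof (rule covering_arc_long)
  note le = hulls[THEN arc_hullD(1)]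
  show "a0 \<le> d1" using le ord by simp
  have "arc_hull (P \<union> Q) a0 b1"
    by (rule arc_hull_Un[OF hulls(1,2)]) (use le ord in auto)
  then have "arc_hull (P \<union> Q \<union> P') a0 c1"
    by (rule arc_hull_Un[OF _ hulls(3)]) (use le ord in auto)
  then have "arc_hull (P \<union> Q \<union> P' \<union> Q') a0 d1"
    by (rule arc_hull_Un[OF _ hulls(4)]) (use le ord in auto)
  then show "A \<subseteq> v ` {a0..d1}" unfolding A by (rule arc_hullD(5))
qed

lemma in_orderE:
  assumes "in_order p r Z Z'" "r < p + n"
  obtains a0 a1 b0 b1 where "p \<le> a0" "a1 < b0" "b1 \<le> r" "arc_hull Z a0 a1" "arc_hull Z' b0 b1"
    "arc_hull (Z \<union> Z') a0 b1" "pos b1 - pos a0 \<le> pos r - pos p"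
proof -
  obtain a0 a1 b0 b1 where ord: "p \<le> a0" "a1 < b0" "b1 \<le> r"
    and hulls: "arc_hull Z a0 a1" "arc_hull Z' b0 b1"
    using assms(1) unfolding in_order_def by blast
  have "arc_hull (Z \<union> Z') a0 b1"
    by (rule arc_hull_Un[OF hulls]) (use ord assms(2) in auto)
  moreover have "pos b1 - pos a0 \<le> pos r - pos p"
    using pos_mono[OF ord(1)] pos_mono[OF ord(3)] by simp
  ultimately show thesis using that ord hulls by blast
qed

lemma not_H_split_in_order:
  assumes H: "H_split f A X1 X2 Y1 Y2"
    and ord: "in_order p r X1 X2" "in_order q s Y1 Y2" "p \<le> r" "r < q" "q \<le> s" "s < p + n"
    and short: "pos r - pos p \<le> f (X1 \<union> X2)" "pos s - pos q \<le> f (Y1 \<union> Y2)"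
  shows False
proof -
  obtain a0 a1 b0 b1 where ab: "p \<le> a0" "a1 < b0" "b1 \<le> r" "arc_hull X1 a0 a1" "arc_hull X2 b0 b1"
    and X: "arc_hull (X1 \<union> X2) a0 b1" "pos b1 - pos a0 \<le> pos r - pos p"
    by (rule in_orderE[OF ord(1)]) (use ord(4-6) in auto)
  obtain c0 c1 d0 d1 where cd: "q \<le> c0" "c1 < d0" "d1 \<le> s" "arc_hull Y1 c0 c1" "arc_hull Y2 d0 d1"
    and Y: "arc_hull (Y1 \<union> Y2) c0 d1" "pos d1 - pos c0 \<le> pos s - pos q"
    by (rule in_orderE[OF ord(2)]) (use ord(3,4,6) in auto)
  have bc: "b1 < c0" and da: "d1 < a0 + n" using ab cd ord(4,6) by auto
  have ab': "a1 + n < b0 + n" and bc': "b1 + n < c0 + n" and cd': "c1 + n < d0 + n"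
    using ab(2) bc cd(2) by auto
  note shifted = ab(4,5)[THEN arc_hull_add_period] cd(4)[THEN arc_hull_add_period]
  have A: "X1 \<union> X2 \<union> Y1 \<union> Y2 = A" "X2 \<union> Y1 \<union> Y2 \<union> X1 = A" "Y1 \<union> Y2 \<union> X1 \<union> X2 = A"
    "Y2 \<union> X1 \<union> X2 \<union> Y1 = A" and proper: "X1 \<union> Y1 \<subset> A" "X2 \<union> Y2 \<subset> A"
    and total: "f (X1 \<union> X2) + f (Y1 \<union> Y2) + f (X1 \<union> Y1) + f (X2 \<union> Y2) \<le> 2 * f A"
    using H unfolding H_split_def by auto
  have long: "f A < pos d1 - pos a0" "f A < pos a1 + pos n - pos b0"
    "f A < pos b1 + pos n - pos c0" "f A < pos c1 + pos n - pos d0"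
    using cyclic_arc_hulls_long[OF ab(4,5) cd(4,5) ab(2) bc cd(2) da A(1)]
      cyclic_arc_hulls_long[OF ab(5) cd(4,5) shifted(1) bc cd(2) da ab' A(2)]
      cyclic_arc_hulls_long[OF cd(4,5) shifted(1,2) cd(2) da ab' bc' A(3)]
      cyclic_arc_hulls_long[OF cd(5) shifted da ab' bc' cd' A(4)]
    by (simp_all add: pos_add_period)
  have wide: "pos n - f A \<le> pos b1 - pos a0" "pos n - f A \<le> pos d1 - pos c0"
    using arc_hull_wide[OF X(1)] arc_hull_wide[OF Y(1)] H unfolding H_split_def by auto
  note le = arc_hullD(1)[OF ab(4), THEN pos_mono] arc_hullD(1)[OF ab(5), THEN pos_mono]
    arc_hullD(1)[OF cd(4), THEN pos_mono] arc_hullD(1)[OF cd(5), THEN pos_mono]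
  have "pos c1 - pos a0 \<le> f (X1 \<union> Y1) \<or> pos a1 + pos n - pos c0 \<le> f (X1 \<union> Y1)"
    using crossing_pair_long[OF ab(4,5) cd(4,5) ab(2) bc cd(2) da A(1) proper(1)]
    by (simp add: pos_add_period)
  moreover have "pos d1 - pos b0 \<le> f (X2 \<union> Y2) \<or> pos b1 + pos n - pos d0 \<le> f (X2 \<union> Y2)"
    using crossing_pair_long[OF ab(5) cd(4,5) shifted(1) bc cd(2) da ab' A(2) proper(2)]
    by (simp add: pos_add_period)
  \<comment> \<open>The two arcs cover \<open>A\<close> and overlap in a third arc. Together with the hulls of \<open>X1 \<union> X2\<close> and
    \<open>Y1 \<union> Y2\<close> the overlap covers \<open>A\<close> again or, if it is one of these hulls, is by \<open>wide\<close> and \<open>long\<close>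
    longer than the gap between the two.\<close>
  ultimately show False
    by (elim disjE)
      (use total order_trans[OF X(2) short(1)] order_trans[OF Y(2) short(2)] long wide le in linarith)+
qed

lemma not_H_split: "\<not> H_split f A X1 X2 Y1 Y2"
proof
  assume H: "H_split f A X1 X2 Y1 Y2"
  then have disj: "X1 \<inter> X2 = {}" "Y1 \<inter> Y2 = {}" and ne: "X1 \<noteq> {}" "X2 \<noteq> {}" "Y1 \<noteq> {}" "Y2 \<noteq> {}"
    and XY: "X1 \<union> X2 \<subset> A" "Y1 \<union> Y2 \<subset> A" "A - (X1 \<union> X2) = Y1 \<union> Y2" "A - (Y1 \<union> Y2) = X1 \<union> X2"
    and cheap: "\<And>Z. Z \<in> {X1, X2, Y1, Y2, X1 \<union> X2} \<Longrightarrow> f Z + f (A - Z) \<le> f A"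
    unfolding H_split_def by auto
  have "X1 \<union> X2 \<noteq> {}" using ne by blast
  then obtain p r q s where hull: "arc_hull (X1 \<union> X2) p r" "arc_hull (Y1 \<union> Y2) q s"
    and sep: "r < q" "s < p + n"
    and short: "pos r - pos p \<le> f (X1 \<union> X2)" "pos s - pos q \<le> f (Y1 \<union> Y2)"
    using disjoint_arc_hulls[OF XY(1) _ cheap] unfolding XY(3) by blast
  note hullD = arc_hullD[OF hull(1)] arc_hullD[OF hull(2)]
  have "in_order p r X1 X2 \<or> in_order p r X2 X1"
    by (rule in_order_linear[OF XY(1) disj(1) ne(1,2) cheap cheap hull(1), of q])
      (use XY(3) sep hullD in auto)
  moreover have "in_order q s Y1 Y2 \<or> in_order q s Y2 Y1"
    by (rule in_order_linear[OF XY(2) disj(2) ne(3,4) cheap cheap hull(2), of "p + n"])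
      (use XY(4) sep hullD in auto)
  moreover have False if "H_split f A Z Z' T T'" "in_order p r Z Z'" "in_order q s T T'"
    "Z \<union> Z' = X1 \<union> X2" "T \<union> T' = Y1 \<union> Y2" for Z Z' T T'
    using not_H_split_in_order[OF that(1-3) hullD(1) sep(1) hullD(6) sep(2)] short that(4,5) by simp
  ultimately show False
    using H H_split_swap_X H_split_swap_Y by (metis Un_commute)
qed

end

section \<open>Cycles\<close>

locale cycle_graph = weighted_graph VC EC ends len
  for VC :: "'v set" and EC :: "'e set" and ends :: "'e \<Rightarrow> 'v set" and len :: "'e \<Rightarrow> real" +
  fixes v :: "nat \<Rightarrow> 'v" and e :: "nat \<Rightarrow> 'e" and n :: nat
  assumes n_pos: "0 < n" and v_eq_iff: "v i = v j \<longleftrightarrow> i mod n = j mod n"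
    and e_eq_iff: "e i = e j \<longleftrightarrow> i mod n = j mod n" and ends_e: "ends (e i) = {v i, v (Suc i)}"
    and VC_eq: "VC = range v" and EC_eq: "EC = range e"

sublocale cycle_graph \<subseteq> weighted_circle v n "\<lambda>i. len (e i)"
proof
  show "len (e i) = len (e j)" if "v i = v j" for i j
    using that v_eq_iff e_eq_iff by metis
qed (use n_pos v_eq_iff len_nonneg EC_eq in auto)

context cycle_graph
begin

lemma connects_arc: "p \<le> r \<Longrightarrow> connects (e ` {p..<r}) (v ` {p..r})"
proof (induction r rule: dec_induct)
  case base
  then show ?case using connects_singleton[of "v p"] VC_eq by simp
next
  case (step r)
  have "connects {e r} {v r, v (Suc r)}"
    using ends_e EC_eq by (intro connects_edge) auto
  with step have "connects (e ` {p..<r} \<union> {e r}) (v ` {p..r} \<union> {v r, v (Suc r)})"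
    by (intro connects_union[where x = "v r"]) auto
  moreover have "v ` {p..r} \<union> {v r, v (Suc r)} = v ` {p..Suc r}"
    "e ` {p..<r} \<union> {e r} = e ` {p..<Suc r}"
    using step.hyps by (auto simp: atLeastAtMostSuc_conv atLeastLessThanSuc)
  ultimately show ?case by simp
qed

lemma adj_arc_closed:
  assumes F: "F \<subseteq> EC" "e k \<notin> F" "e m \<notin> F" and m: "k \<le> m" "m < k + n"
    and xy: "(x, y) \<in> adj F ends" "x \<in> v ` {Suc k..m}"
  shows "y \<in> v ` {Suc k..m}"
proof -
  obtain f where f: "f \<in> F" "ends f = {x, y}" using xy(1) unfolding adj_def by blast
  then obtain i' where "f = e i'" using F(1) EC_eq by blast
  then obtain i where i: "Suc k \<le> i" "i < Suc k + n" "f = e i"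
    using ex_in_window[of "Suc k" i'] e_eq_iff v_eq_iff by metis
  have "e (k + n) = e k" unfolding e_eq_iff by simp
  then have "i \<noteq> k + n" "i \<noteq> m" using i(3) f(1) F(2,3) by auto
  have xy_i: "{x, y} = {v i, v (Suc i)}" using f(2) i(3) ends_e by simp
  obtain j where j: "Suc k \<le> j" "j \<le> m" "x = v j" using xy(2) by auto
  have "i < m"
  proof (rule ccontr)
    assume "\<not> i < m"
    have "v j \<noteq> v i"
      by (rule v_neq_in_window) (use \<open>\<not> i < m\<close> \<open>i \<noteq> m\<close> j(1,2) i(2) in auto)
    moreover have "v j \<noteq> v (Suc i)"
      by (rule v_neq_in_window) (use \<open>\<not> i < m\<close> \<open>i \<noteq> k + n\<close> j(1,2) i(2) in auto)
    ultimately show False using xy_i j(3) by auto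
  qed
  then have "v i \<in> v ` {Suc k..m}" "v (Suc i) \<in> v ` {Suc k..m}" using i(1) by auto
  then show ?thesis using xy_i by (auto simp: doubleton_eq_iff)
qed

lemma connects_imp_arc:
  assumes "connects F U" "U \<noteq> {}"
  obtains p r where "arc_hull U p r" "e ` {p..<r} \<subseteq> F"
proof -
  obtain k where k: "e k \<notin> F \<or> EC \<subseteq> F" using EC_eq by blast
  have "U \<subseteq> range v" using connects_vertices[OF assms(1)] VC_eq by simp
  then obtain p r where pr: "Suc k \<le> p" "r < Suc k + n" "arc_hull U p r"
    using window_arc_hull assms(2) by blast
  have "e m \<in> F" if m: "p \<le> m" "m < r" for m
  proof (rule ccontr)
    assume "e m \<notin> F"
    then have "e k \<notin> F" using k EC_eq by blast
    have F: "F \<subseteq> EC" using assms(1) by (rule connects_subset)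
    have "adj F ends `` (v ` {Suc k..m}) \<subseteq> v ` {Suc k..m}"
      using adj_arc_closed[OF F \<open>e k \<notin> F\<close> \<open>e m \<notin> F\<close>] m pr(1,2) by auto
    then have "(adj F ends)\<^sup>* `` (v ` {Suc k..m}) = v ` {Suc k..m}"
      by (rule Image_closed_trancl)
    moreover have "(v p, v r) \<in> (adj F ends)\<^sup>*"
      using assms(1) arc_hullD(3,4)[OF pr(3)] unfolding connects_def connected_graph_def by blast
    moreover have "v p \<in> v ` {Suc k..m}" using m(1) pr(1) by simp
    ultimately have "v r \<in> v ` {Suc k..m}" by blast
    then obtain j where "Suc k \<le> j" "j \<le> m" "v r = v j" by auto
    then show False using v_neq_in_window[of j r] m(2) pr(2) by simp
  qed
  then have "e ` {p..<r} \<subseteq> F" by auto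
  with pr(3) show thesis by (rule that)
qed

lemma glen_arc:
  assumes "p \<le> r" "r \<le> p + n"
  shows "glen len (e ` {p..<r}) = pos r - pos p"
proof -
  have "inj_on e {p..<r}"
  proof (rule linorder_inj_onI)
    show "e i \<noteq> e j" if "i < j" "i \<in> {p..<r}" "j \<in> {p..<r}" for i j
      using v_neq_in_window[of i j] that assms(2) e_eq_iff v_eq_iff by auto
  qed auto
  then show ?thesis
    unfolding glen_def using sum_wt_eq[OF assms(1)] by (simp add: sum.reindex)
qed

lemma sd_le_iff_arc_cover: "sd U \<le> ereal c \<longleftrightarrow> arc_cover U c"
proof
  assume le: "sd U \<le> ereal c"
  show "arc_cover U c"
  proof (cases "U = {}")
    case True
    have "ereal 0 \<le> ereal c" using sd_nonneg le unfolding zero_ereal_def by (rule order_trans)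
    then show ?thesis using True unfolding arc_cover_def by (intro exI[of _ 0]) simp
  next
    case False
    have "sd U < \<infinity>" using le by auto
    then obtain F where F: "connects F U" "sd U = ereal (glen len F)"
      by (rule sd_attained)
    obtain p r where pr: "arc_hull U p r" "e ` {p..<r} \<subseteq> F"
      using connects_imp_arc[OF F(1) False] .
    have "pos r - pos p = glen len (e ` {p..<r})"
      using arc_hullD(1,2)[OF pr(1)] by (simp add: glen_arc)
    also have "\<dots> \<le> glen len F" using pr(2) connects_subset[OF F(1)] by (rule glen_mono)
    also have "\<dots> \<le> c" using F(2) le by simp
    finally show ?thesis using arc_hullD(1,5)[OF pr(1)] unfolding arc_cover_def by blast
  qed
next
  assume "arc_cover U c"
  then obtain p r where pr: "p \<le> r" "U \<subseteq> v ` {p..r}" "pos r - pos p \<le> c"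
    unfolding arc_cover_def by blast
  have "sd U \<le> sd (v ` {p..r})" using pr(2) by (rule sd_mono)
  also have "\<dots> \<le> ereal (glen len (e ` {p..<r}))" using connects_arc[OF pr(1)] by (rule sd_le)
  also have "glen len (e ` {p..<r}) \<le> (\<Sum>i\<in>{p..<r}. len (e i))"
    unfolding glen_def using sum_image_le[of "{p..<r}" len e] wt_nonneg by (simp add: comp_def)
  also have "\<dots> \<le> c" using pr(3) sum_wt_eq[OF pr(1)] by simp
  finally show "sd U \<le> ereal c" by simp
qed

lemma sd_finite:
  assumes "U \<subseteq> VC"
  shows "sd U < \<infinity>"
proof -
  have "v i \<in> v ` {0..n}" for i
  proof -
    obtain j where "j < 0 + n" "v j = v i" using ex_in_window[of 0 i] by blast
    then have "j \<in> {0..n}" "v i = v j" by simp_all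
    then show ?thesis by (rule image_eqI[rotated])
  qed
  then have "U \<subseteq> v ` {0..n}" using assms VC_eq by auto
  then have "arc_cover U (pos n - pos 0)" unfolding arc_cover_def by blast
  then have "sd U \<le> ereal (pos n - pos 0)" unfolding sd_le_iff_arc_cover .
  then show ?thesis by auto
qed

end

lemma range_nth_mod:
  assumes "xs \<noteq> []"
  shows "range (\<lambda>i. xs ! (i mod length xs)) = set xs"
proof (intro set_eqI iffI)
  fix x assume "x \<in> set xs"
  then obtain i where "i < length xs" "x = xs ! i" by (auto simp: in_set_conv_nth)
  then have "x = xs ! (i mod length xs)" by simp
  then show "x \<in> range (\<lambda>i. xs ! (i mod length xs))" by (rule range_eqI)
qed (use assms in auto)

lemma is_cycle_imp_cycle_graph:
  assumes "weighted_graph VC EC ends len" "is_cycle ends VC EC"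
  obtains v e n where "cycle_graph VC EC ends len v e n"
proof -
  obtain vs es where c: "length vs \<ge> 2" "length es = length vs" "distinct vs" "distinct es"
    "\<And>i. i < length vs \<Longrightarrow> ends (es ! i) = {vs ! i, vs ! (Suc i mod length vs)}"
    "VC = set vs" "EC = set es"
    using assms(2) unfolding is_cycle_def by auto
  let ?n = "length vs"
  have n: "0 < ?n" using c(1) by linarith
  have "cycle_graph_axioms VC EC ends (\<lambda>i. vs ! (i mod ?n)) (\<lambda>i. es ! (i mod ?n)) ?n"
  proof
    show "0 < ?n" by (rule n)
    show "vs ! (i mod ?n) = vs ! (j mod ?n) \<longleftrightarrow> i mod ?n = j mod ?n"
      "es ! (i mod ?n) = es ! (j mod ?n) \<longleftrightarrow> i mod ?n = j mod ?n" for i j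
      using c(2-4) mod_less_divisor[OF n] by (simp_all add: nth_eq_iff_index_eq)
    show "ends (es ! (i mod ?n)) = {vs ! (i mod ?n), vs ! (Suc i mod ?n)}" for i
      using c(5)[of "i mod ?n"] n by (simp add: mod_Suc_eq)
    show "VC = range (\<lambda>i. vs ! (i mod ?n))" using range_nth_mod[of vs] n c(6) by simp
    have "es \<noteq> []" using n c(2) by auto
    from range_nth_mod[OF this] show "EC = range (\<lambda>i. es ! (i mod ?n))"
      unfolding c(2,7) ..
  qed
  then show thesis using that assms(1) unfolding cycle_graph_def by blast
qed

lemma steiner_dist_subgraph_le:
  assumes "subgraph V' E' V E ends"
  shows "steiner_dist ends len V E A \<le> steiner_dist ends len V' E' A"
  unfolding steiner_dist_def
proof (rule Inf_superset_mono)
  have "subgraph W F V E ends" if "subgraph W F V' E' ends" for W F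
    using assms that unfolding subgraph_def by auto
  then show "{ereal (glen len F) |W F. subgraph W F V' E' ends \<and> connected_graph W F ends \<and> A \<subseteq> W}
    \<subseteq> {ereal (glen len F) |W F. subgraph W F V E ends \<and> connected_graph W F ends \<and> A \<subseteq> W}"
    by blast
qed

lemma cycle_steiner_dist_step:
  assumes "weighted_graph V E ends len" "cycle_graph VC EC ends len v e n"
    and sub: "subgraph VC EC V E ends"
    and A: "A \<subseteq> VC" "7 \<le> card A"
    and psub: "\<And>B. B \<subset> A \<Longrightarrow> steiner_dist ends len VC EC B = steiner_dist ends len V E B"
  shows "steiner_dist ends len VC EC A = steiner_dist ends len V E A"
proof (rule ccontr)
  interpret G: weighted_graph V E ends len by fact
  interpret C: cycle_graph VC EC ends len v e n by fact
  assume "C.sd A \<noteq> G.sd A"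
  then have less: "G.sd A < C.sd A" using steiner_dist_subgraph_le[OF sub, of len A] by simp
  have fin: "G.sd B < \<infinity>" if "B \<subseteq> A" for B
    using steiner_dist_subgraph_le[OF sub, of len B] C.sd_finite[of B] A(1) that
    by (meson order_trans order_le_less_trans)
  interpret critical_set v n "\<lambda>i. len (e i)" G.rsd A
  proof
    show "A \<subseteq> range v" using A(1) C.VC_eq by simp
    show "\<not> C.arc_cover A (G.rsd A)"
      using less fin[OF order_refl] by (simp add: G.ereal_rsd flip: C.sd_le_iff_arc_cover)
    fix B assume B: "B \<subset> A"
    then have rsd: "ereal (G.rsd B) = G.sd B" using fin by (intro G.ereal_rsd) blast
    show "C.arc_cover B (G.rsd B)" unfolding C.sd_le_iff_arc_cover[symmetric] rsd by (simp add: psub B)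
    have "G.sd B \<le> G.sd A" using B by (intro G.sd_mono) blast
    then show "G.rsd B \<le> G.rsd A" using G.ereal_rsd[OF fin] by (intro G.rsd_le) simp
  qed
  show False by (rule G.sd_H_split[OF A(2) fin[OF order_refl]]) (simp add: not_H_split)
qed

lemma weighted_graph_subgraph:
  assumes "weighted_graph V E ends len" "subgraph V' E' V E ends"
  shows "weighted_graph V' E' ends len"
  using assms unfolding weighted_graph_def graph_def subgraph_def by (auto intro: finite_subset)

theorem theorem2:
  fixes V :: "'v set" and E :: "'e set" and ends :: "'e \<Rightarrow> 'v set" and len :: "'e \<Rightarrow> real"
    and VC :: "'v set" and EC :: "'e set"
  assumes "graph V E ends"
    and "\<forall>e\<in>E. len e > 0"
    and "subgraph VC EC V E ends"
    and "is_cycle ends VC EC"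
    and "k_geodesic 6 ends len VC EC V E"
  shows "fully_geodesic ends len VC EC V E"
proof -
  have G: "weighted_graph V E ends len"
    using assms(1,2) by unfold_locales (auto intro: less_imp_le)
  then obtain v e n where C: "cycle_graph VC EC ends len v e n"
    using is_cycle_imp_cycle_graph[OF weighted_graph_subgraph[OF _ assms(3)] assms(4)] by metis
  have "finite VC" using assms(4) unfolding is_cycle_def by auto
  have "steiner_dist ends len VC EC A = steiner_dist ends len V E A" if "A \<subseteq> VC" for A
    using finite_subset[OF that \<open>finite VC\<close>] that
  proof (induction A rule: finite_psubset_induct)
    case (psubset A)
    show ?case
    proof (cases "card A \<le> 6")
      case True
      then show ?thesis using assms(5) psubset.prems unfolding k_geodesic_def by blast
    next
      case False
      then have "7 \<le> card A" by simp
      with G C assms(3) psubset.prems show ?thesis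
        by (rule cycle_steiner_dist_step) (use psubset.IH psubset.prems in blast)
    qed
  qed
  then show ?thesis unfolding fully_geodesic_def k_geodesic_def by blast
qed

end
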